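(* Let $\Omega\subset\mathbb{R}^n$ be a (possibly unbounded) domain with the following property: for any $x_0\in\partial\Omega$ and any $s>0$ small, there exist $\nu\in C(\overline{\Omega}\cap B_s(x_0);\mathbb{R}^n)$ and $c>0$ small such that $B_{c\tau}(y+\tau\nu(y))\subset\Omega$ for all $y\in\overline{\Omega}\cap B_s(x_0)$ and $0<\tau\le c$. Let $F:\Omega\times\mathbb{R}^n\times\mathbb{S}^n\to\mathbb{R}$ satisfy: (i) $F\in C(\Omega\times\mathbb{R}^n\times\mathbb{S}^n)$; (ii) $F(x,p,X)\le F(x,p,Y)$ for all $x\in\Omega$, $p\in\mathbb{R}^n$ and $X,Y\in\mathbb{S}^n$ with $X\ge Y$; (iii) for any modulus of continuity $\omega$, $$\sup\{|F(x,p,X)|:\ x\in\Omega,\ d(x)\le\delta,\ |p|\le\omega(\delta)/\delta,\ |X|\le\omega(\delta)/\delta^2\}\to0\quad\text{as }\delta\to0;$$ (iv) $\sup_{x\in\Omega}|F(x,p,X)|\to0$ as $|p|,|X|\to0$. If $u\in C(\Omega)$ is a bounded viscosity solution of $$u+F(x,\nabla u,\nabla^2u)=0\quad\text{in }\Omega$$ that can be continuously extended to $\partial\Omega$ (i.e. $u$ extends to a function in $C(\overline{\Omega})$), then $u\equiv0$ in $\Omega$.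
   Context: $\mathbb{S}^n$ is the set of all real symmetric $n\times n$ matrices with the usual partial order; $B_r(x)$ is the open ball centered at $x$ with radius $r$; $d(x)$ denotes the distance from $x\in\overline{\Omega}$ to $\partial\Omega$. A modulus of continuity is a nonnegative increasing function $\omega\in C([0,\infty))$ with $\omega(0)=0$. Viscosity solutions. A locally bounded upper (resp. lower) semicontinuous function $u$ in $\Omega$ is a viscosity subsolution (resp. supersolution) of $u+F(x,\nabla u,\nabla^2u)=0$ in $\Omega$ if whenever $x_0\in\Omega$ and $\varphi\in C^2(\Omega)$ are such that $u-\varphi$ attains a local maximum (resp. minimum) at $x_0$, one has $u(x_0)+F(x_0,\nabla\varphi(x_0),\nabla^2\varphi(x_0))\le0$ (resp. $\ge0$). A function $u\in C(\Omega)$ is a viscosity solution if it is both a viscosity subsolution and a viscosity supersolution. *)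

theory Defs
  imports "HOL-Analysis.Analysis"
begin

section \<open>Symmetric matrices\<close>

definition sym_mats :: "(real^'n^'n) set" where
  "sym_mats = {X. transpose X = X}"

(* The usual (positive semidefinite) partial order on symmetric matrices.  The library order
   on real^'n^'n is the entrywise one and is not used. *)
definition loewner_le :: "real^'n^'n \<Rightarrow> real^'n^'n \<Rightarrow> bool" where
  "loewner_le Y X \<longleftrightarrow> (\<forall>v. v \<bullet> (Y *v v) \<le> v \<bullet> (X *v v))"

section \<open>Domains\<close>

definition domain_set :: "(real^'n) set \<Rightarrow> bool" where
  "domain_set \<Omega> \<longleftrightarrow> open \<Omega> \<and> connected \<Omega> \<and> \<Omega> \<noteq> {}"

(* Extended-real valued, so that the distance to the boundary is \<infinity> when \<Omega> is the whole space;
   infdist would give 0 there. *)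
definition bdry_dist :: "(real^'n) set \<Rightarrow> real^'n \<Rightarrow> ereal" where
  "bdry_dist \<Omega> x = (INF y\<in>frontier \<Omega>. ereal (dist x y))"

definition interior_ball_field_property :: "(real^'n) set \<Rightarrow> bool" where
  "interior_ball_field_property \<Omega> \<longleftrightarrow>
     (\<forall>x0\<in>frontier \<Omega>. \<forall>\<^sub>F s in at_right 0.
        \<exists>(\<nu> :: real^'n \<Rightarrow> real^'n) c. continuous_on (closure \<Omega> \<inter> ball x0 s) \<nu> \<and> c > 0 \<and>
          (\<forall>y \<in> closure \<Omega> \<inter> ball x0 s. \<forall>\<tau>. 0 < \<tau> \<and> \<tau> \<le> c \<longrightarrow>
             ball (y + \<tau> *\<^sub>R \<nu> y) (c * \<tau>) \<subseteq> \<Omega>))"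

definition modulus_of_continuity :: "(real \<Rightarrow> real) \<Rightarrow> bool" where
  "modulus_of_continuity \<omega> \<longleftrightarrow>
     continuous_on {0..} \<omega> \<and> mono_on {0..} \<omega> \<and> (\<forall>t\<ge>0. 0 \<le> \<omega> t) \<and> \<omega> 0 = 0"

section \<open>Test functions of class C2\<close>

definition grad :: "(real^'n \<Rightarrow> real) \<Rightarrow> real^'n \<Rightarrow> real^'n" where
  "grad \<phi> x = (\<chi> i. frechet_derivative \<phi> (at x) (axis i 1))"

definition hess :: "(real^'n \<Rightarrow> real) \<Rightarrow> real^'n \<Rightarrow> real^'n^'n" where
  "hess \<phi> x = matrix (frechet_derivative (grad \<phi>) (at x))"

(* Meant for open \<Omega>, where only the values of \<phi> on \<Omega> matter. *)
definition C2_on :: "(real^'n) set \<Rightarrow> (real^'n \<Rightarrow> real) \<Rightarrow> bool" where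
  "C2_on \<Omega> \<phi> \<longleftrightarrow>
     (\<forall>x\<in>\<Omega>. \<phi> differentiable (at x)) \<and>
     (\<forall>x\<in>\<Omega>. grad \<phi> differentiable (at x)) \<and>
     continuous_on \<Omega> (hess \<phi>)"

section \<open>Viscosity solutions\<close>

definition locally_bounded_on :: "(real^'n) set \<Rightarrow> (real^'n \<Rightarrow> real) \<Rightarrow> bool" where
  "locally_bounded_on \<Omega> u \<longleftrightarrow> (\<forall>x\<in>\<Omega>. \<exists>r>0. bounded (u ` (\<Omega> \<inter> ball x r)))"

definition usc_on :: "(real^'n) set \<Rightarrow> (real^'n \<Rightarrow> real) \<Rightarrow> bool" where
  "usc_on \<Omega> u \<longleftrightarrow> (\<forall>x\<in>\<Omega>. \<forall>a > u x. \<forall>\<^sub>F y in at x within \<Omega>. u y < a)"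

definition lsc_on :: "(real^'n) set \<Rightarrow> (real^'n \<Rightarrow> real) \<Rightarrow> bool" where
  "lsc_on \<Omega> u \<longleftrightarrow> (\<forall>x\<in>\<Omega>. \<forall>a < u x. \<forall>\<^sub>F y in at x within \<Omega>. a < u y)"

definition local_max_on :: "(real^'n) set \<Rightarrow> (real^'n \<Rightarrow> real) \<Rightarrow> real^'n \<Rightarrow> bool" where
  "local_max_on \<Omega> f x0 \<longleftrightarrow> (\<exists>r>0. \<forall>y \<in> \<Omega> \<inter> ball x0 r. f y \<le> f x0)"

definition local_min_on :: "(real^'n) set \<Rightarrow> (real^'n \<Rightarrow> real) \<Rightarrow> real^'n \<Rightarrow> bool" where
  "local_min_on \<Omega> f x0 \<longleftrightarrow> (\<exists>r>0. \<forall>y \<in> \<Omega> \<inter> ball x0 r. f x0 \<le> f y)"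

(* The equation is u + F(x, grad u, hess u) = 0 in \<Omega>. *)
definition viscosity_subsolution ::
    "(real^'n) set \<Rightarrow> (real^'n \<Rightarrow> real^'n \<Rightarrow> real^'n^'n \<Rightarrow> real) \<Rightarrow> (real^'n \<Rightarrow> real) \<Rightarrow> bool" where
  "viscosity_subsolution \<Omega> F u \<longleftrightarrow>
     locally_bounded_on \<Omega> u \<and> usc_on \<Omega> u \<and>
     (\<forall>x0 \<phi>. x0 \<in> \<Omega> \<and> C2_on \<Omega> \<phi> \<and> local_max_on \<Omega> (\<lambda>y. u y - \<phi> y) x0 \<longrightarrow>
        u x0 + F x0 (grad \<phi> x0) (hess \<phi> x0) \<le> 0)"

definition viscosity_supersolution ::
    "(real^'n) set \<Rightarrow> (real^'n \<Rightarrow> real^'n \<Rightarrow> real^'n^'n \<Rightarrow> real) \<Rightarrow> (real^'n \<Rightarrow> real) \<Rightarrow> bool" where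
  "viscosity_supersolution \<Omega> F u \<longleftrightarrow>
     locally_bounded_on \<Omega> u \<and> lsc_on \<Omega> u \<and>
     (\<forall>x0 \<phi>. x0 \<in> \<Omega> \<and> C2_on \<Omega> \<phi> \<and> local_min_on \<Omega> (\<lambda>y. u y - \<phi> y) x0 \<longrightarrow>
        u x0 + F x0 (grad \<phi> x0) (hess \<phi> x0) \<ge> 0)"

definition viscosity_solution ::
    "(real^'n) set \<Rightarrow> (real^'n \<Rightarrow> real^'n \<Rightarrow> real^'n^'n \<Rightarrow> real) \<Rightarrow> (real^'n \<Rightarrow> real) \<Rightarrow> bool" where
  "viscosity_solution \<Omega> F u \<longleftrightarrow>
     continuous_on \<Omega> u \<and> viscosity_subsolution \<Omega> F u \<and> viscosity_supersolution \<Omega> F u"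

end

theory Submission
  imports Defs
begin

text \<open>
  At a boundary point, the modulus of continuity \<open>\<omega>\<close> of the extension lets a paraboloid of
  height \<open>C \<omega>(\<delta>)\<close> on a ball of radius comparable to \<open>\<delta>\<close>, contained in
  \<open>\<Omega>\<close>, touch \<open>u\<close> from above inside that ball. Its gradient and Hessian are exactly of
  the size admitted in (iii), so letting \<open>\<delta> \<rightarrow> 0\<close> gives \<open>u \<le> 0\<close> on the boundary. If
  \<open>M = sup u\<close> were positive, a paraboloid with small second derivative centred at a
  near-maximum point would touch \<open>u\<close> from above inside \<open>\<Omega>\<close> at a value close to \<open>M\<close>, against
  (iv). The same applied to \<open>-u\<close> and \<open>-F(x, -p, -X)\<close> gives \<open>u \<ge> 0\<close>.
\<close>

section \<open>Paraboloids as test functions\<close>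

lemma has_derivative_paraboloid:
  fixes z :: "real^'n"
  shows "((\<lambda>y. a * (norm (y - z))\<^sup>2) has_derivative (\<lambda>h. 2 * a * ((y - z) \<bullet> h))) (at y)"
  unfolding power2_norm_eq_inner
  by (auto intro!: derivative_eq_intros simp: inner_commute algebra_simps)

text \<open>An equality of functions rather than of values, because \<open>hess\<close>
  differentiates the function \<open>grad \<phi>\<close> as a whole.\<close>

lemma grad_paraboloid:
  fixes z :: "real^'n"
  shows "grad (\<lambda>y. a * (norm (y - z))\<^sup>2) = (\<lambda>y. (2 * a) *\<^sub>R (y - z))"
proof
  fix y :: "real^'n"
  have "frechet_derivative (\<lambda>y. a * (norm (y - z))\<^sup>2) (at y) = (\<lambda>h. 2 * a * ((y - z) \<bullet> h))"
    using has_derivative_paraboloid by (rule frechet_derivative_at[symmetric])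
  then show "grad (\<lambda>y. a * (norm (y - z))\<^sup>2) y = (2 * a) *\<^sub>R (y - z)"
    by (simp add: grad_def vec_eq_iff inner_axis)
qed

lemma has_derivative_scaled_diff:
  fixes z :: "'a::real_normed_vector"
  shows "((\<lambda>y. b *\<^sub>R (y - z)) has_derivative (\<lambda>h. b *\<^sub>R h)) (at y)"
  by (auto intro!: derivative_eq_intros)

lemma hess_paraboloid:
  fixes z :: "real^'n"
  shows "hess (\<lambda>y. a * (norm (y - z))\<^sup>2) = (\<lambda>y. (2 * a) *\<^sub>R mat 1)"
proof
  fix y :: "real^'n"
  have "frechet_derivative (\<lambda>y. (2 * a) *\<^sub>R (y - z)) (at y) = (\<lambda>h. (2 * a) *\<^sub>R h)"
    using has_derivative_scaled_diff by (rule frechet_derivative_at[symmetric])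
  then show "hess (\<lambda>y. a * (norm (y - z))\<^sup>2) y = (2 * a) *\<^sub>R mat 1"
    by (simp add: hess_def grad_paraboloid matrix_def mat_def vec_eq_iff axis_def)
qed

lemma C2_on_paraboloid:
  fixes z :: "real^'n"
  shows "C2_on S (\<lambda>y. a * (norm (y - z))\<^sup>2)"
  unfolding C2_on_def hess_paraboloid grad_paraboloid
  by (intro conjI ballI continuous_on_const differentiableI[OF has_derivative_paraboloid]
      differentiableI[OF has_derivative_scaled_diff])

section \<open>Matrices arising as Hessians of paraboloids\<close>

lemma scaled_mat_in_sym_mats: "a *\<^sub>R mat 1 \<in> (sym_mats :: (real^'n^'n) set)"
  by (simp add: sym_mats_def transpose_def mat_def vec_eq_iff)

text \<open>The limit in (iv) is taken over a punctured neighbourhood of the origin, so the Hessian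
  used there has to be nonzero.\<close>

lemma norm_mat_1_pos: "0 < norm (mat 1 :: real^'n^'n)"
proof -
  have "(mat 1 :: real^'n^'n) $ i $ i \<noteq> 0 $ i $ i" for i
    by (simp add: mat_def)
  then have "(mat 1 :: real^'n^'n) \<noteq> 0" by metis
  then show ?thesis by simp
qed

lemma uminus_in_sym_mats: "X \<in> sym_mats \<Longrightarrow> - X \<in> sym_mats"
  by (simp add: sym_mats_def transpose_def vec_eq_iff)

section \<open>Moduli of continuity\<close>

text \<open>Hypothesis (iii) is applied to this modulus: \<open>K\<close> absorbs the geometric
  constants of the paraboloid, and the added \<open>t\<close> keeps its height positive even where
  \<open>\<omega>\<close> vanishes.\<close>

lemma modulus_of_continuity_affine:
  assumes "modulus_of_continuity \<omega>" "0 \<le> K"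
  shows "modulus_of_continuity (\<lambda>t. K * (\<omega> t + t))"
  using assms unfolding modulus_of_continuity_def mono_on_def
  by (auto intro!: continuous_intros mult_left_mono add_mono)

text \<open>The supremum of the functions \<open>t \<mapsto> g y \<cdot> min 1 (t / r y)\<close> is continuous because each of
  them grows by at most the factor \<open>t / s\<close> from \<open>s\<close> to \<open>t\<close>.\<close>

lemma modulus_of_continuity_dominating:
  fixes g r :: "'a \<Rightarrow> real"
  assumes ne: "A \<noteq> {}"
    and r: "\<And>y. y \<in> A \<Longrightarrow> 0 < r y"
    and g0: "\<And>y. y \<in> A \<Longrightarrow> 0 \<le> g y"
    and gM: "\<And>y. y \<in> A \<Longrightarrow> g y \<le> M"
    and small: "\<And>e. 0 < e \<Longrightarrow> \<exists>d>0. \<forall>y\<in>A. r y \<le> d \<longrightarrow> g y \<le> e"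
  shows "\<exists>\<omega>. modulus_of_continuity \<omega> \<and> (\<forall>y\<in>A. \<forall>t\<ge>r y. g y \<le> \<omega> t)"
proof -
  \<comment> \<open>The weight \<open>min 1 (t / r y)\<close> is 1 as soon as
    \<open>t \<ge> r y\<close>, which gives the domination, and is 0 at
    \<open>t = 0\<close>.\<close>
  define \<omega> where "\<omega> t = (SUP y\<in>A. g y * min 1 (t / r y))" for t
  have le_M: "g y * min 1 (t / r y) \<le> M" if "y \<in> A" "0 \<le> t" for y t
  proof -
    have "g y * min 1 (t / r y) \<le> g y * 1"
      using g0[OF that(1)] by (intro mult_left_mono) auto
    then show ?thesis using gM[OF that(1)] by simp
  qed
  have bdd: "bdd_above ((\<lambda>y. g y * min 1 (t / r y)) ` A)" if "0 \<le> t" for t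
    using le_M that by (auto intro!: bdd_aboveI)
  have upper: "g y * min 1 (t / r y) \<le> \<omega> t" if "y \<in> A" "0 \<le> t" for y t
    unfolding \<omega>_def using that by (intro cSUP_upper bdd)
  have least: "\<omega> t \<le> b" if "\<And>y. y \<in> A \<Longrightarrow> g y * min 1 (t / r y) \<le> b" for t b
    unfolding \<omega>_def using that ne by (intro cSUP_least)
  have zero: "\<omega> 0 = 0"
    unfolding \<omega>_def using ne by simp
  have mono: "\<omega> s \<le> \<omega> t" if "0 \<le> s" "s \<le> t" for s t
  proof (rule least)
    fix y assume y: "y \<in> A"
    have "g y * min 1 (s / r y) \<le> g y * min 1 (t / r y)"
      using r[OF y] g0[OF y] that
      by (intro mult_left_mono min.mono) (auto intro: divide_right_mono)
    also have "\<dots> \<le> \<omega> t" using y that by (intro upper) auto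
    finally show "g y * min 1 (s / r y) \<le> \<omega> t" .
  qed
  have M0: "0 \<le> M" using ne g0 gM by (meson equals0I order_trans)
  have \<omega>_M: "\<omega> t \<le> M" if "0 \<le> t" for t
    using le_M that by (intro least)
  have growth: "\<omega> t \<le> t / s * \<omega> s" if "0 < s" "s \<le> t" for s t
  proof (rule least)
    fix y assume y: "y \<in> A"
    \<comment> \<open>The quotient of \<open>min 1 (t / r y)\<close> by \<open>t\<close> is
      nonincreasing in \<open>t\<close>.\<close>
    have "min 1 (t / r y) \<le> t / s * min 1 (s / r y)"
      using r[OF y] that by (auto simp: min_def field_simps)
    then have "g y * min 1 (t / r y) \<le> g y * (t / s * min 1 (s / r y))"
      using g0[OF y] by (rule mult_left_mono)
    also have "\<dots> = t / s * (g y * min 1 (s / r y))" by simp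
    also have "\<dots> \<le> t / s * \<omega> s"
      using upper[OF y, of s] that by (intro mult_left_mono) auto
    finally show "g y * min 1 (t / r y) \<le> t / s * \<omega> s" .
  qed
  have at_0: "\<exists>d>0. \<forall>t. 0 \<le> t \<and> t < d \<longrightarrow> \<omega> t \<le> e" if "0 < e" for e
  proof -
    obtain d where d: "0 < d" "\<And>y. y \<in> A \<Longrightarrow> r y \<le> d \<Longrightarrow> g y \<le> e"
      using small[OF \<open>0 < e\<close>] by blast
    \<comment> \<open>Points with \<open>r y \<le> d\<close> are handled by the smallness of
      \<open>g\<close>, the others by \<open>t / r y \<le> t / d\<close>. The denominator
      \<open>M + 1\<close> stays positive when \<open>M = 0\<close>.\<close>
    have "\<omega> t \<le> e" if t: "0 \<le> t" "t < d * e / (M + 1)" for t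
    proof (rule least)
      fix y assume y: "y \<in> A"
      show "g y * min 1 (t / r y) \<le> e"
      proof (cases "r y \<le> d")
        case True
        have "g y * min 1 (t / r y) \<le> g y * 1"
          using g0[OF y] by (intro mult_left_mono) auto
        then show ?thesis using d(2)[OF y True] by simp
      next
        case False
        have "g y * min 1 (t / r y) \<le> M * (t / d)"
        proof (intro mult_mono gM y)
          have "t / r y \<le> t / d" using False d(1) t by (intro divide_left_mono) auto
          then show "min 1 (t / r y) \<le> t / d" by simp
          show "0 \<le> min 1 (t / r y)" using t r[OF y] by simp
        qed fact
        also have "\<dots> \<le> (M + 1) * (t / d)" using t d(1) by (intro mult_right_mono) auto
        also have "\<dots> \<le> e" using t(2) d(1) M0 by (simp add: field_simps)
        finally show ?thesis .
      qed
    qed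
    then show ?thesis
      using d(1) \<open>0 < e\<close> M0 by (intro exI[of _ "d * e / (M + 1)"]) auto
  qed
  \<comment> \<open>Growth by at most the factor \<open>t / s\<close>, together with the bound
    \<open>M\<close>, is a Lipschitz estimate away from 0; continuity at 0 comes from
    \<open>at_0\<close>.\<close>
  have increment: "\<omega> t - \<omega> s \<le> M * (t - s) / s" if "0 < s" "s \<le> t" for s t
  proof -
    have "\<omega> t - \<omega> s \<le> (t - s) / s * \<omega> s"
      using growth[OF that] that by (simp add: field_simps)
    also have "\<dots> \<le> (t - s) / s * M"
      using that \<omega>_M[of s] by (intro mult_left_mono) auto
    finally show ?thesis by (simp add: mult.commute)
  qed
  have cont: "continuous_on {0..} \<omega>"
  proof (rule continuous_onI)
    fix x e :: real assume x: "x \<in> {0..}" and e: "0 < e"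
    show "\<exists>d>0. \<forall>x'\<in>{0..}. dist x' x < d \<longrightarrow> dist (\<omega> x') (\<omega> x) \<le> e"
    proof (cases "x = 0")
      case True
      obtain d where d: "0 < d" "\<And>t. 0 \<le> t \<Longrightarrow> t < d \<Longrightarrow> \<omega> t \<le> e"
        using at_0[OF e] by blast
      have "dist (\<omega> t) (\<omega> x) \<le> e" if "t \<in> {0..}" "dist t x < d" for t
        using d(2)[of t] mono[of 0 t] that True zero by (simp add: dist_real_def)
      then show ?thesis using d(1) by blast
    next
      case False
      with x have x0: "0 < x" by simp
      \<comment> \<open>The first bound keeps both points above \<open>x / 2\<close>; the second
        makes the Lipschitz estimate there at most \<open>e\<close>.\<close>
      define d where "d = min (x / 2) (e * x / (2 * (M + 1)))"
      have d: "0 < d" using x0 e M0 by (simp add: d_def)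
      have d2: "d \<le> x / 2" by (simp only: d_def min.cobounded1)
      have "d \<le> e * x / (2 * (M + 1))" by (simp only: d_def min.cobounded2)
      then have d': "2 * (M + 1) * d \<le> e * x"
        using M0 by (simp add: field_simps)
      have key: "\<omega> t - \<omega> s \<le> e" if "x / 2 \<le> s" "s \<le> t" "t - s \<le> d" for s t
      proof -
        have "M * (t - s) \<le> (M + 1) * d"
          using that M0 by (intro mult_mono) auto
        also have "\<dots> \<le> e * (x / 2)" using d' by (simp add: algebra_simps)
        also have "\<dots> \<le> e * s" using that e by (intro mult_left_mono) auto
        finally have "M * (t - s) / s \<le> e" using that x0 by (simp add: field_simps)
        then show ?thesis using increment[of s t] that x0 by linarith
      qed
      have "dist (\<omega> t) (\<omega> x) \<le> e" if "t \<in> {0..}" "dist t x < d" for t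
      proof (cases "t \<le> x")
        case True
        then show ?thesis
          using key[of t x] mono[of t x] that d2 by (auto simp: dist_real_def)
      next
        case False
        then show ?thesis
          using key[of x t] mono[of x t] that d2 x0 by (auto simp: dist_real_def)
      qed
      then show ?thesis using d by blast
    qed
  qed
  have "modulus_of_continuity \<omega>"
    unfolding modulus_of_continuity_def
    using cont mono zero mono[OF order_refl] by (auto simp: mono_on_def)
  moreover have "g y \<le> \<omega> t" if "y \<in> A" "r y \<le> t" for y t
    using upper[OF that(1), of t] r[OF that(1)] that(2) by (simp add: min_def split: if_splits)
  ultimately show ?thesis by blast
qed

section \<open>Boundary distance and pointwise bounds from suprema\<close>

lemma bdry_dist_le:
  assumes "y \<in> frontier S" "dist x y \<le> d"
  shows "bdry_dist S x \<le> ereal d"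
proof -
  have "bdry_dist S x \<le> ereal (dist x y)"
    unfolding bdry_dist_def using assms(1) by (rule INF_lower)
  then show ?thesis using assms(2) by (meson ereal_less_eq(3) order_trans)
qed

text \<open>Turns the limits in (iii) and (iv), stated with suprema in \<open>ennreal\<close>, into
  pointwise bounds on the operator.\<close>

lemma ennreal_abs_le_of_SUP_less:
  assumes "(SUP i\<in>I. ennreal \<bar>f i\<bar>) < ennreal e" "i \<in> I"
  shows "\<bar>f i\<bar> \<le> e"
proof -
  have "ennreal \<bar>f i\<bar> < ennreal e"
    using assms by (metis SUP_upper le_less_trans)
  then show ?thesis
    by (metis abs_ge_zero ennreal_less_iff less_eq_real_def)
qed

section \<open>Sign of the boundary values\<close>

text \<open>The equation enters through paraboloid tests alone, so the lemma serves both
  \<open>u\<close> with \<open>F\<close> and \<open>- u\<close> with the reflected operator. The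
  touching point lies within \<open>\<delta>\<close> of \<open>x0\<close>, so its value bounds
  \<open>v x0\<close> up to \<open>\<omega> \<delta>\<close>.\<close>

lemma nonpos_on_frontier:
  fixes F :: "real^'n \<Rightarrow> real^'n \<Rightarrow> real^'n^'n \<Rightarrow> real"
    and u v :: "real^'n \<Rightarrow> real"
  assumes ball_field: "interior_ball_field_property S"
    and F: "\<And>\<omega> e. modulus_of_continuity \<omega> \<Longrightarrow> 0 < e \<Longrightarrow>
       \<forall>\<^sub>F \<delta> in at_right 0. \<forall>x p X. x \<in> S \<longrightarrow> X \<in> sym_mats \<longrightarrow> bdry_dist S x \<le> ereal \<delta> \<longrightarrow>
          norm p \<le> \<omega> \<delta> / \<delta> \<longrightarrow> norm X \<le> \<omega> \<delta> / \<delta>\<^sup>2 \<longrightarrow> \<bar>F x p X\<bar> \<le> e"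
    and sub: "\<And>x z a. x \<in> S \<Longrightarrow> local_max_on S (\<lambda>y. u y - a * (norm (y - z))\<^sup>2) x \<Longrightarrow>
       u x + F x ((2 * a) *\<^sub>R (x - z)) ((2 * a) *\<^sub>R mat 1) \<le> 0"
    and "open S" and bdd: "bounded (u ` S)"
    and cont: "continuous_on (closure S) v" and ext: "\<And>x. x \<in> S \<Longrightarrow> v x = u x"
    and x0: "x0 \<in> frontier S"
  shows "v x0 \<le> 0"
proof -
  have x0_cl: "x0 \<in> closure S" and x0_not: "x0 \<notin> S"
    using x0 \<open>open S\<close> by (auto simp: frontier_def interior_open)
  obtain s \<nu> c where "0 < s" "0 < c"
    and balls0: "\<forall>y \<in> closure S \<inter> ball x0 s. \<forall>\<tau>. 0 < \<tau> \<and> \<tau> \<le> c \<longrightarrow>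
             ball (y + \<tau> *\<^sub>R \<nu> y) (c * \<tau>) \<subseteq> S"
  proof -
    have "\<forall>\<^sub>F s in at_right 0. 0 < s \<and> (\<exists>(\<nu> :: real^'n \<Rightarrow> real^'n) c.
        continuous_on (closure S \<inter> ball x0 s) \<nu> \<and> c > 0 \<and>
          (\<forall>y \<in> closure S \<inter> ball x0 s. \<forall>\<tau>. 0 < \<tau> \<and> \<tau> \<le> c \<longrightarrow>
             ball (y + \<tau> *\<^sub>R \<nu> y) (c * \<tau>) \<subseteq> S))"
      using ball_field x0 unfolding interior_ball_field_property_def
      by (intro eventually_conj eventually_at_right_less) auto
    then show ?thesis
      using that eventually_happens'[OF trivial_limit_at_right_real] by blast
  qed
  define w where "w = \<nu> x0"
  have balls: "ball (x0 + \<tau> *\<^sub>R w) (c * \<tau>) \<subseteq> S" if "0 < \<tau>" "\<tau> \<le> c" for \<tau>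
    using balls0 x0_cl \<open>0 < s\<close> that by (simp add: w_def)
  obtain B where B: "\<And>y. y \<in> S \<Longrightarrow> \<bar>u y\<bar> \<le> B"
    using bdd unfolding bounded_iff by auto
  \<comment> \<open>Boundedness of \<open>u\<close> makes the modulus at \<open>x0\<close> valid on
    all of \<open>S\<close>; the distances to \<open>x0\<close> are positive since \<open>x0\<close>
    lies outside the open set \<open>S\<close>.\<close>
  obtain \<omega> where \<omega>: "modulus_of_continuity \<omega>"
    and osc: "\<And>y t. y \<in> S \<Longrightarrow> dist y x0 \<le> t \<Longrightarrow> \<bar>u y - v x0\<bar> \<le> \<omega> t"
  proof -
    have "\<exists>\<omega>. modulus_of_continuity \<omega> \<and> (\<forall>y\<in>S. \<forall>t\<ge>dist y x0. \<bar>u y - v x0\<bar> \<le> \<omega> t)"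
    proof (rule modulus_of_continuity_dominating[where M = "B + \<bar>v x0\<bar>"])
      show "S \<noteq> {}" using x0_cl by auto
      show "0 < dist y x0" if "y \<in> S" for y using that x0_not by auto
      show "\<bar>u y - v x0\<bar> \<le> B + \<bar>v x0\<bar>" if "y \<in> S" for y
        using B[OF that] by linarith
      fix e :: real assume "0 < e"
      then obtain d where d: "0 < d" "\<And>y. y \<in> closure S \<Longrightarrow> dist y x0 < d \<Longrightarrow> dist (v y) (v x0) < e"
        using cont x0_cl unfolding continuous_on_iff by blast
      have "\<bar>u y - v x0\<bar> \<le> e" if "y \<in> S" "dist y x0 \<le> d / 2" for y
        using d(1) d(2)[of y] that ext[of y] closure_subset[of S] by (auto simp: dist_real_def)
      then show "\<exists>d>0. \<forall>y\<in>S. dist y x0 \<le> d \<longrightarrow> \<bar>u y - v x0\<bar> \<le> e"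
        using d(1) by (intro exI[of _ "d / 2"]) auto
    qed simp
    then show ?thesis using that by blast
  qed
  \<comment> \<open>The ball of radius \<open>c * \<tau>\<close> about
    \<open>x0 + \<tau> *\<^sub>R w\<close> stays within \<open>L * \<tau>\<close> of
    \<open>x0\<close>.\<close>
  define L where "L = norm w + c"
  have "0 < L" using \<open>0 < c\<close> by (simp add: L_def add_nonneg_pos)
  \<comment> \<open>The two summands are the constants that the gradient and the Hessian of the
    paraboloid chosen below produce in units of \<open>h / \<delta>\<close> and of \<open>h\<close>
    over \<open>\<delta>\<close> squared.\<close>
  define K where "K = 16 * L / c + 32 * L\<^sup>2 / c\<^sup>2 * norm (mat 1 :: real^'n^'n)"
  have K_parts: "0 \<le> K" "16 * L / c \<le> K" "32 * L\<^sup>2 / c\<^sup>2 * norm (mat 1 :: real^'n^'n) \<le> K"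
    using \<open>0 < c\<close> \<open>0 < L\<close> by (auto simp: K_def)
  have mod: "modulus_of_continuity (\<lambda>t. K * (\<omega> t + t))"
    using \<omega> K_parts(1) by (rule modulus_of_continuity_affine)
  have \<omega>_nonneg: "0 \<le> \<omega> t" if "0 \<le> t" for t
    using \<omega> that by (simp add: modulus_of_continuity_def)
  have "v x0 \<le> e" if "0 < e" for e
  proof -
    have "(\<omega> \<longlongrightarrow> \<omega> 0) (at 0 within {0..})"
      using \<omega> unfolding modulus_of_continuity_def continuous_on_def by (meson atLeast_iff order_refl)
    then have "(\<omega> \<longlongrightarrow> \<omega> 0) (at_right 0)"
      by (rule tendsto_within_subset) auto
    moreover have "\<omega> 0 = 0" using \<omega> by (simp add: modulus_of_continuity_def)
    ultimately have "(\<omega> \<longlongrightarrow> 0) (at_right 0)" by simp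
    then have ev\<omega>: "\<forall>\<^sub>F \<delta> in at_right 0. \<omega> \<delta> < e / 2"
      using \<open>0 < e\<close> by (intro order_tendstoD(2)) auto
    have "\<forall>\<^sub>F \<delta> in at_right 0. \<delta> < L * c"
      using \<open>0 < L\<close> \<open>0 < c\<close> eventually_at_right_real[of 0 "L * c"]
      by (auto elim: eventually_mono)
    moreover have "\<forall>\<^sub>F \<delta> in at_right (0::real). 0 < \<delta>"
      by (rule eventually_at_right_less)
    moreover have "0 < e / 2" using \<open>0 < e\<close> by simp
    note F[OF mod this]
    ultimately have "\<forall>\<^sub>F \<delta> in at_right 0. 0 < \<delta> \<and> \<delta> < L * c \<and> \<omega> \<delta> < e / 2 \<and>
       (\<forall>x p X. x \<in> S \<longrightarrow> X \<in> sym_mats \<longrightarrow> bdry_dist S x \<le> ereal \<delta> \<longrightarrow>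
          norm p \<le> K * (\<omega> \<delta> + \<delta>) / \<delta> \<longrightarrow> norm X \<le> K * (\<omega> \<delta> + \<delta>) / \<delta>\<^sup>2 \<longrightarrow> \<bar>F x p X\<bar> \<le> e / 2)"
      using ev\<omega> by eventually_elim auto
    then obtain \<delta> where \<delta>: "0 < \<delta>" "\<delta> < L * c" "\<omega> \<delta> < e / 2"
      and F\<delta>: "\<And>x p X. x \<in> S \<Longrightarrow> X \<in> sym_mats \<Longrightarrow> bdry_dist S x \<le> ereal \<delta> \<Longrightarrow>
          norm p \<le> K * (\<omega> \<delta> + \<delta>) / \<delta> \<Longrightarrow> norm X \<le> K * (\<omega> \<delta> + \<delta>) / \<delta>\<^sup>2 \<Longrightarrow> \<bar>F x p X\<bar> \<le> e / 2"
      using eventually_happens'[OF trivial_limit_at_right_real] by blast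
    \<comment> \<open>The scale for which the ball reaches at most distance \<open>\<delta>\<close>
      from \<open>x0\<close>; the restriction \<open>\<delta> < L * c\<close> yields
      \<open>\<tau> < c\<close>.\<close>
    define \<tau> where "\<tau> = \<delta> / L"
    have \<tau>: "0 < \<tau>" "\<tau> < c" "\<delta> = L * \<tau>"
      using \<delta> \<open>0 < L\<close> by (auto simp: \<tau>_def field_simps)
    define z where "z = x0 + \<tau> *\<^sub>R w"
    define h where "h = \<omega> \<delta> + \<delta>"
    have h: "0 < h" "\<omega> \<delta> < h" using \<delta>(1) \<omega>_nonneg[of \<delta>] by (auto simp: h_def)
    \<comment> \<open>Makes the paraboloid equal to \<open>4 * h\<close> on the sphere of radius
      \<open>c * \<tau> / 2\<close>, while \<open>u\<close> varies by less than \<open>2 * h\<close>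
      on that ball.\<close>
    define a where "a = 16 * h / (c\<^sup>2 * \<tau>\<^sup>2)"
    have "0 < a" using h \<open>0 < c\<close> \<tau>(1) by (simp add: a_def)
    have in_S: "y \<in> S" if "y \<in> cball z (c * \<tau> / 2)" for y
    proof -
      have "c * \<tau> / 2 < c * \<tau>" using \<open>0 < c\<close> \<tau>(1) by simp
      then have "y \<in> ball z (c * \<tau>)" using that by (metis mem_ball mem_cball le_less_trans)
      then show ?thesis using balls[of \<tau>] \<tau> by (auto simp: z_def)
    qed
    have near: "dist y x0 \<le> \<delta>" if "y \<in> cball z (c * \<tau> / 2)" for y
    proof -
      have "dist y x0 \<le> dist z y + dist z x0" by (rule dist_triangle3)
      also have "\<dots> \<le> c * \<tau> / 2 + \<tau> * norm w"
      proof (rule add_mono)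
        show "dist z y \<le> c * \<tau> / 2" using that by simp
        show "dist z x0 \<le> \<tau> * norm w" using \<tau>(1) by (simp add: z_def dist_norm)
      qed
      also have "\<dots> \<le> \<delta>" using \<tau> \<open>0 < c\<close> by (simp add: L_def algebra_simps)
      finally show ?thesis .
    qed
    have osc_ball: "\<bar>u y - v x0\<bar> \<le> \<omega> \<delta>" if "y \<in> cball z (c * \<tau> / 2)" for y
      using osc in_S near that by blast
    have z_in: "z \<in> cball z (c * \<tau> / 2)" using \<open>0 < c\<close> \<tau>(1) by simp
    have "continuous_on (cball z (c * \<tau> / 2)) v"
      using cont in_S closure_subset by (meson continuous_on_subset subset_iff)
    then have "continuous_on (cball z (c * \<tau> / 2)) (\<lambda>y. v y - a * (norm (y - z))\<^sup>2)"
      by (intro continuous_intros)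
    then obtain x where x: "x \<in> cball z (c * \<tau> / 2)"
      and max0: "\<forall>y \<in> cball z (c * \<tau> / 2). v y - a * (norm (y - z))\<^sup>2 \<le> v x - a * (norm (x - z))\<^sup>2"
      using continuous_attains_sup[OF compact_cball] z_in by blast
    have max: "u y - a * (norm (y - z))\<^sup>2 \<le> u x - a * (norm (x - z))\<^sup>2"
      if "y \<in> cball z (c * \<tau> / 2)" for y
      using max0 that ext in_S x by metis
    \<comment> \<open>On the sphere, comparison with the centre \<open>z\<close> would force
      \<open>u x - u z \<ge> 4 * h\<close>, more than the oscillation allows.\<close>
    have inner: "dist z x < c * \<tau> / 2"
    proof (rule ccontr)
      assume "\<not> ?thesis"
      then have "norm (x - z) = c * \<tau> / 2" using x by (simp add: dist_norm norm_minus_commute)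
      then have "a * (norm (x - z))\<^sup>2 = 4 * h"
        using \<open>0 < c\<close> \<tau>(1) by (simp only: a_def) (simp add: power_divide power_mult_distrib)
      then have "4 * h \<le> u x - u z" using max[OF z_in] by simp
      then show False using osc_ball[OF x] osc_ball[OF z_in] h by linarith
    qed
    have "local_max_on S (\<lambda>y. u y - a * (norm (y - z))\<^sup>2) x"
      unfolding local_max_on_def
    proof (intro exI[of _ "c * \<tau> / 2 - dist z x"] conjI ballI)
      fix y assume "y \<in> S \<inter> ball x (c * \<tau> / 2 - dist z x)"
      then have "y \<in> cball z (c * \<tau> / 2)"
        using dist_triangle[of z y x] by simp
      then show "u y - a * (norm (y - z))\<^sup>2 \<le> u x - a * (norm (x - z))\<^sup>2" by (rule max)
    qed (use inner in simp)
    then have eq: "u x + F x ((2 * a) *\<^sub>R (x - z)) ((2 * a) *\<^sub>R mat 1) \<le> 0"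
      using sub in_S x by blast
    have "norm ((2 * a) *\<^sub>R (x - z)) = 2 * a * norm (x - z)" using \<open>0 < a\<close> by simp
    also have "\<dots> \<le> 2 * a * (c * \<tau> / 2)"
      using x \<open>0 < a\<close> by (intro mult_left_mono) (auto simp: dist_norm norm_minus_commute)
    also have "\<dots> = (16 * L / c) * h / \<delta>"
      using \<tau> \<open>0 < c\<close> \<open>0 < L\<close> by (simp add: a_def field_simps power2_eq_square)
    also have "\<dots> \<le> K * h / \<delta>"
      using K_parts h \<delta> by (intro divide_right_mono mult_right_mono) auto
    finally have p: "norm ((2 * a) *\<^sub>R (x - z)) \<le> K * (\<omega> \<delta> + \<delta>) / \<delta>" by (simp add: h_def)
    have "norm ((2 * a) *\<^sub>R (mat 1 :: real^'n^'n)) = 2 * a * norm (mat 1 :: real^'n^'n)"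
      using \<open>0 < a\<close> by simp
    also have "\<dots> = (32 * L\<^sup>2 / c\<^sup>2 * norm (mat 1 :: real^'n^'n)) * h / \<delta>\<^sup>2"
      using \<tau> \<open>0 < c\<close> \<open>0 < L\<close> by (simp add: a_def field_simps power2_eq_square)
    also have "\<dots> \<le> K * h / \<delta>\<^sup>2"
      using K_parts h \<delta> by (intro divide_right_mono mult_right_mono) auto
    finally have X: "norm ((2 * a) *\<^sub>R (mat 1 :: real^'n^'n)) \<le> K * (\<omega> \<delta> + \<delta>) / \<delta>\<^sup>2"
      by (simp add: h_def)
    have "\<bar>F x ((2 * a) *\<^sub>R (x - z)) ((2 * a) *\<^sub>R mat 1)\<bar> \<le> e / 2"
      using in_S[OF x] scaled_mat_in_sym_mats bdry_dist_le[OF x0 near[OF x]] p X by (rule F\<delta>)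
    \<comment> \<open>The equation gives \<open>u x \<le> e / 2\<close>, and \<open>v x0\<close>
      exceeds \<open>u x\<close> by at most \<open>\<omega> \<delta> < e / 2\<close>.\<close>
    then show ?thesis using eq osc_ball[OF x] \<delta>(3) by linarith
  qed
  then show ?thesis by (rule field_le_epsilon[of _ 0, simplified])
qed

section \<open>Maximum principle in the interior\<close>

text \<open>The supremum need not be attained when \<open>S\<close> is unbounded. A flat paraboloid
  centred at a near-maximum point localises it to a compact piece of the closure, and the boundary
  sign pushes the localised maximum into \<open>S\<close>.\<close>

lemma nonpos_of_nonpos_on_frontier:
  fixes F :: "real^'n \<Rightarrow> real^'n \<Rightarrow> real^'n^'n \<Rightarrow> real"
    and u v :: "real^'n \<Rightarrow> real"
  assumes F: "\<And>e. 0 < e \<Longrightarrow> \<exists>\<eta>>0. \<forall>x\<in>S. \<forall>p. \<forall>X\<in>sym_mats.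
       X \<noteq> 0 \<longrightarrow> norm p \<le> \<eta> \<longrightarrow> norm X \<le> \<eta> \<longrightarrow> \<bar>F x p X\<bar> \<le> e"
    and sub: "\<And>x z a. x \<in> S \<Longrightarrow> local_max_on S (\<lambda>y. u y - a * (norm (y - z))\<^sup>2) x \<Longrightarrow>
       u x + F x ((2 * a) *\<^sub>R (x - z)) ((2 * a) *\<^sub>R mat 1) \<le> 0"
    and "open S" and bdd: "bounded (u ` S)"
    and cont: "continuous_on (closure S) v" and ext: "\<And>x. x \<in> S \<Longrightarrow> v x = u x"
    and bdry: "\<And>x. x \<in> frontier S \<Longrightarrow> v x \<le> 0"
    and "x1 \<in> S"
  shows "u x1 \<le> 0"
proof (rule ccontr)
  assume "\<not> ?thesis"
  then have "0 < u x1" by simp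
  define M where "M = (SUP x\<in>S. u x)"
  have bdda: "bdd_above (u ` S)" using bdd by (rule bounded_imp_bdd_above)
  have le_M: "u x \<le> M" if "x \<in> S" for x
    unfolding M_def using that bdda by (rule cSUP_upper)
  have "0 < M" using le_M[OF \<open>x1 \<in> S\<close>] \<open>0 < u x1\<close> by linarith
  let ?m = "norm (mat 1 :: real^'n^'n)"
  have "0 < M / 2" using \<open>0 < M\<close> by simp
  obtain \<eta> where "0 < \<eta>"
    and F\<eta>: "\<And>x p X. x \<in> S \<Longrightarrow> X \<in> sym_mats \<Longrightarrow>
       X \<noteq> 0 \<Longrightarrow> norm p \<le> \<eta> \<Longrightarrow> norm X \<le> \<eta> \<Longrightarrow> \<bar>F x p X\<bar> \<le> M / 2"
    using F[OF \<open>0 < M / 2\<close>] by blast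
  \<comment> \<open>The first bound keeps values above \<open>M - e\<close> at least
    \<open>M / 2\<close>; the second makes the gradient bound \<open>4 * e\<close> and the Hessian
    norm \<open>4 * e * ?m\<close> at most \<open>\<eta>\<close>.\<close>
  define e where "e = min (M / 2) (\<eta> / (4 * (1 + ?m)))"
  have "0 < 1 + ?m" by (rule add_pos_nonneg) auto
  then have "0 < e" using \<open>0 < \<eta>\<close> \<open>0 < M\<close> by (simp add: e_def)
  have "e \<le> M / 2" by (simp only: e_def min.cobounded1)
  have e_bound: "4 * e * (1 + ?m) \<le> \<eta>"
  proof -
    have "e \<le> \<eta> / (4 * (1 + ?m))" by (simp only: e_def min.cobounded2)
    then show ?thesis using \<open>0 < 1 + ?m\<close> by (simp add: field_simps)
  qed
  have e4: "4 * e \<le> \<eta>" "4 * e * ?m \<le> \<eta>"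
  proof -
    have "0 \<le> e * ?m" using \<open>0 < e\<close> by simp
    moreover have "4 * e + 4 * (e * ?m) \<le> \<eta>" using e_bound by (simp add: algebra_simps)
    ultimately have "4 * e \<le> \<eta>" "4 * (e * ?m) \<le> \<eta>" using \<open>0 < e\<close> by linarith+
    then show "4 * e \<le> \<eta>" "4 * e * ?m \<le> \<eta>" by simp_all
  qed
  obtain z where z: "z \<in> S" "M - e < u z"
    using less_cSUP_iff[of S u "M - e"] bdda \<open>x1 \<in> S\<close> \<open>0 < e\<close> unfolding M_def by auto
  \<comment> \<open>On the unit sphere about \<open>z\<close> the penalty is \<open>2 * e\<close>,
    whereas \<open>u\<close> can exceed \<open>u z\<close> by less than \<open>e\<close>; this keeps
    the maximum point inside the unit ball.\<close>
  define \<phi> where "\<phi> y = 2 * e * (norm (y - z))\<^sup>2" for y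
  have "compact (closure S \<inter> cball z 1)" by (simp add: closed_Int_compact)
  moreover have z_in: "z \<in> closure S \<inter> cball z 1" using z closure_subset by auto
  moreover have "continuous_on (closure S \<inter> cball z 1) (\<lambda>y. v y - \<phi> y)"
    unfolding \<phi>_def
    using continuous_on_subset[OF cont Int_lower1] by (intro continuous_intros)
  ultimately obtain x where x: "x \<in> closure S \<inter> cball z 1"
    and max: "\<And>y. y \<in> closure S \<inter> cball z 1 \<Longrightarrow> v y - \<phi> y \<le> v x - \<phi> x"
    using continuous_attains_sup[of "closure S \<inter> cball z 1" "\<lambda>y. v y - \<phi> y"] by blast
  have \<phi>_nonneg: "0 \<le> \<phi> y" for y using \<open>0 < e\<close> by (simp add: \<phi>_def)
  have vx: "u z \<le> v x - \<phi> x"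
    using max[OF z_in] ext[OF z(1)] by (simp add: \<phi>_def)
  \<comment> \<open>Positivity is what excludes a frontier point, where
    \<open>v \<le> 0\<close>.\<close>
  have "0 < v x" using vx z(2) \<open>e \<le> M / 2\<close> \<phi>_nonneg[of x] \<open>0 < M\<close> by linarith
  have xS: "x \<in> S"
  proof (rule ccontr)
    assume "x \<notin> S"
    then have "x \<in> frontier S" using x \<open>open S\<close> by (simp add: frontier_def interior_open)
    then show False using bdry \<open>0 < v x\<close> by fastforce
  qed
  have inner: "dist z x < 1"
  proof (rule ccontr)
    assume "\<not> ?thesis"
    then have "norm (x - z) = 1" using x by (simp add: dist_norm norm_minus_commute)
    then have "\<phi> x = 2 * e" by (simp add: \<phi>_def)
    then show False using vx z(2) le_M[OF xS] ext[OF xS] \<open>0 < e\<close> by linarith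
  qed
  have "local_max_on S (\<lambda>y. u y - (2 * e) * (norm (y - z))\<^sup>2) x"
    unfolding local_max_on_def
  proof (intro exI[of _ "1 - dist z x"] conjI ballI)
    fix y assume y: "y \<in> S \<inter> ball x (1 - dist z x)"
    then have "y \<in> closure S \<inter> cball z 1"
      using dist_triangle[of z y x] closure_subset by auto
    then show "u y - 2 * e * (norm (y - z))\<^sup>2 \<le> u x - 2 * e * (norm (x - z))\<^sup>2"
      using max[of y] y ext xS by (simp add: \<phi>_def)
  qed (use inner in simp)
  then have eq: "u x + F x ((2 * (2 * e)) *\<^sub>R (x - z)) ((2 * (2 * e)) *\<^sub>R mat 1) \<le> 0"
    using sub xS by blast
  have "norm ((2 * (2 * e)) *\<^sub>R (x - z)) \<le> 4 * e * 1"
    using inner \<open>0 < e\<close> by (simp add: dist_norm norm_minus_commute)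
  then have p: "norm ((2 * (2 * e)) *\<^sub>R (x - z)) \<le> \<eta>" using e4(1) by linarith
  have X: "norm ((2 * (2 * e)) *\<^sub>R (mat 1 :: real^'n^'n)) \<le> \<eta>"
    using e4(2) \<open>0 < e\<close> by simp
  have "(2 * (2 * e)) *\<^sub>R (mat 1 :: real^'n^'n) \<noteq> 0"
    using norm_mat_1_pos[where 'n = 'n] \<open>0 < e\<close> by auto
  then have "\<bar>F x ((2 * (2 * e)) *\<^sub>R (x - z)) ((2 * (2 * e)) *\<^sub>R mat 1)\<bar> \<le> M / 2"
    using F\<eta>[OF xS scaled_mat_in_sym_mats _ p X] by blast
  \<comment> \<open>The equation gives \<open>u x \<le> M / 2\<close>, but
    \<open>u x \<ge> u z > M - e \<ge> M / 2\<close>.\<close>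
  then show False
    using eq vx z(2) \<open>e \<le> M / 2\<close> ext[OF xS] \<phi>_nonneg[of x] by linarith
qed

section \<open>Vanishing of the solution\<close>

theorem theorem1p1:
  fixes \<Omega> :: "(real^'n) set"
    and F :: "real^'n \<Rightarrow> real^'n \<Rightarrow> real^'n^'n \<Rightarrow> real"
    and u :: "real^'n \<Rightarrow> real"
  assumes "domain_set \<Omega>"
    and "interior_ball_field_property \<Omega>"
    and "continuous_on (\<Omega> \<times> UNIV \<times> sym_mats) (\<lambda>(x, p, X). F x p X)"
    and "\<And>x p X Y. x \<in> \<Omega> \<Longrightarrow> X \<in> sym_mats \<Longrightarrow> Y \<in> sym_mats \<Longrightarrow> loewner_le Y X \<Longrightarrow> F x p X \<le> F x p Y"
    and "\<And>\<omega>. modulus_of_continuity \<omega> \<Longrightarrow>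
          ((\<lambda>\<delta>. SUP (x, p, X) \<in> {(x, p, X). x \<in> \<Omega> \<and> X \<in> sym_mats \<and> bdry_dist \<Omega> x \<le> ereal \<delta> \<and>
                     norm p \<le> \<omega> \<delta> / \<delta> \<and> norm X \<le> \<omega> \<delta> / \<delta>\<^sup>2}.
                  ennreal \<bar>F x p X\<bar>) \<longlongrightarrow> 0) (at_right 0)"
    and "((\<lambda>(p, X). SUP x\<in>\<Omega>. ennreal \<bar>F x p X\<bar>) \<longlongrightarrow> 0) (at (0, 0) within UNIV \<times> sym_mats)"
    and "viscosity_solution \<Omega> F u"
    and "bounded (u ` \<Omega>)"
    and "\<exists>v. continuous_on (closure \<Omega>) v \<and> (\<forall>x\<in>\<Omega>. v x = u x)"
  shows "\<forall>x\<in>\<Omega>. u x = 0"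
proof -
  have "open \<Omega>" using assms(1) by (simp add: domain_set_def)
  obtain v where cont: "continuous_on (closure \<Omega>) v" and ext: "\<And>x. x \<in> \<Omega> \<Longrightarrow> v x = u x"
    using assms(9) by blast
  define G where "G x p X = - F x (- p) (- X)" for x p X
  have F_bdry: "\<forall>\<^sub>F \<delta> in at_right 0. \<forall>x p X. x \<in> \<Omega> \<longrightarrow> X \<in> sym_mats \<longrightarrow>
      bdry_dist \<Omega> x \<le> ereal \<delta> \<longrightarrow> norm p \<le> \<omega> \<delta> / \<delta> \<longrightarrow> norm X \<le> \<omega> \<delta> / \<delta>\<^sup>2 \<longrightarrow> \<bar>F x p X\<bar> \<le> e"
    if "modulus_of_continuity \<omega>" "0 < e" for \<omega> e
  proof -
    have "\<forall>\<^sub>F \<delta> in at_right 0. (SUP (x, p, X) \<in> {(x, p, X). x \<in> \<Omega> \<and> X \<in> sym_mats \<and>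
        bdry_dist \<Omega> x \<le> ereal \<delta> \<and> norm p \<le> \<omega> \<delta> / \<delta> \<and> norm X \<le> \<omega> \<delta> / \<delta>\<^sup>2}.
          ennreal \<bar>F x p X\<bar>) < ennreal e"
      using assms(5)[OF that(1)] that(2) by (intro order_tendstoD(2)) auto
    then show ?thesis
    proof eventually_elim
      case (elim \<delta>)
      show ?case
        using ennreal_abs_le_of_SUP_less[OF elim[unfolded case_prod_unfold]] by fastforce
    qed
  qed
  have G_bdry: "\<forall>\<^sub>F \<delta> in at_right 0. \<forall>x p X. x \<in> \<Omega> \<longrightarrow> X \<in> sym_mats \<longrightarrow>
      bdry_dist \<Omega> x \<le> ereal \<delta> \<longrightarrow> norm p \<le> \<omega> \<delta> / \<delta> \<longrightarrow> norm X \<le> \<omega> \<delta> / \<delta>\<^sup>2 \<longrightarrow> \<bar>G x p X\<bar> \<le> e"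
    if "modulus_of_continuity \<omega>" "0 < e" for \<omega> e
    using F_bdry[OF that] by eventually_elim (simp add: G_def uminus_in_sym_mats)
  have F_small: "\<exists>\<eta>>0. \<forall>x\<in>\<Omega>. \<forall>p. \<forall>X\<in>sym_mats.
      X \<noteq> 0 \<longrightarrow> norm p \<le> \<eta> \<longrightarrow> norm X \<le> \<eta> \<longrightarrow> \<bar>F x p X\<bar> \<le> e" if "0 < e" for e
  proof -
    have "\<forall>\<^sub>F q in at (0, 0) within UNIV \<times> sym_mats.
        (case q of (p, X) \<Rightarrow> SUP x\<in>\<Omega>. ennreal \<bar>F x p X\<bar>) < ennreal e"
      using assms(6) that by (intro order_tendstoD(2)) auto
    then obtain d where "0 < d" and d: "\<And>p X. X \<in> sym_mats \<Longrightarrow> (p, X) \<noteq> (0, 0) \<Longrightarrow>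
        dist (p, X) (0, 0) < d \<Longrightarrow> (SUP x\<in>\<Omega>. ennreal \<bar>F x p X\<bar>) < ennreal e"
      unfolding eventually_at by fastforce
    have "\<bar>F x p X\<bar> \<le> e"
      if that: "x \<in> \<Omega>" "X \<in> sym_mats" "X \<noteq> 0" "norm p \<le> d / 3" "norm X \<le> d / 3" for x p X
    proof -
      \<comment> \<open>The radius \<open>d / 3\<close> for each component leaves the pair strictly
        inside the ball of radius \<open>d\<close>.\<close>
      have "norm (p, X) \<le> norm p + norm X" by (rule norm_Pair_le)
      then have "dist (p, X) (0, 0) < d"
        using that(4,5) \<open>0 < d\<close> by (simp add: dist_norm)
      then have "(SUP x\<in>\<Omega>. ennreal \<bar>F x p X\<bar>) < ennreal e"
        using that by (intro d) auto
      then show ?thesis using that(1) by (rule ennreal_abs_le_of_SUP_less)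
    qed
    then show ?thesis using \<open>0 < d\<close> by (intro exI[of _ "d / 3"]) auto
  qed
  have G_small: "\<exists>\<eta>>0. \<forall>x\<in>\<Omega>. \<forall>p. \<forall>X\<in>sym_mats.
      X \<noteq> 0 \<longrightarrow> norm p \<le> \<eta> \<longrightarrow> norm X \<le> \<eta> \<longrightarrow> \<bar>G x p X\<bar> \<le> e" if "0 < e" for e
  proof -
    obtain \<eta> where "0 < \<eta>" and \<eta>: "\<And>x p X. x \<in> \<Omega> \<Longrightarrow> X \<in> sym_mats \<Longrightarrow>
        X \<noteq> 0 \<Longrightarrow> norm p \<le> \<eta> \<Longrightarrow> norm X \<le> \<eta> \<Longrightarrow> \<bar>F x p X\<bar> \<le> e"
      using F_small[OF \<open>0 < e\<close>] by blast
    show ?thesis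
      using \<open>0 < \<eta>\<close> by (intro exI[of _ \<eta>]) (auto simp: G_def intro!: \<eta> uminus_in_sym_mats)
  qed
  have sub_test: "u x + F x (grad \<phi> x) (hess \<phi> x) \<le> 0"
    if "x \<in> \<Omega>" "C2_on \<Omega> \<phi>" "local_max_on \<Omega> (\<lambda>y. u y - \<phi> y) x" for x \<phi>
    using assms(7) that unfolding viscosity_solution_def viscosity_subsolution_def by blast
  have super_test: "0 \<le> u x + F x (grad \<phi> x) (hess \<phi> x)"
    if "x \<in> \<Omega>" "C2_on \<Omega> \<phi>" "local_min_on \<Omega> (\<lambda>y. u y - \<phi> y) x" for x \<phi>
    using assms(7) that unfolding viscosity_solution_def viscosity_supersolution_def by blast
  have sub: "u x + F x ((2 * a) *\<^sub>R (x - z)) ((2 * a) *\<^sub>R mat 1) \<le> 0"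
    if "x \<in> \<Omega>" "local_max_on \<Omega> (\<lambda>y. u y - a * (norm (y - z))\<^sup>2) x" for x z a
    using sub_test[OF that(1) C2_on_paraboloid that(2)]
    by (simp only: grad_paraboloid hess_paraboloid)
  have super: "- u x + G x ((2 * a) *\<^sub>R (x - z)) ((2 * a) *\<^sub>R mat 1) \<le> 0"
    if "x \<in> \<Omega>" "local_max_on \<Omega> (\<lambda>y. - u y - a * (norm (y - z))\<^sup>2) x" for x z a
  proof -
    \<comment> \<open>A paraboloid touching \<open>- u\<close> from above is the negative of one
      touching \<open>u\<close> from below, hence the coefficient \<open>- a\<close>; the sign
      changes in \<open>G\<close> match those of its gradient and Hessian.\<close>
    have "local_min_on \<Omega> (\<lambda>y. u y - (- a) * (norm (y - z))\<^sup>2) x"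
      using that(2) by (simp add: local_max_on_def local_min_on_def algebra_simps)
    then have "0 \<le> u x + F x ((2 * (- a)) *\<^sub>R (x - z)) ((2 * (- a)) *\<^sub>R mat 1)"
      using super_test[OF that(1) C2_on_paraboloid]
      by (simp only: grad_paraboloid hess_paraboloid)
    then show ?thesis by (simp add: G_def)
  qed
  have bdd_minus: "bounded ((\<lambda>x. - u x) ` \<Omega>)"
    using bounded_uminus[of "u ` \<Omega>"] assms(8) by (simp add: image_image)
  have cont_minus: "continuous_on (closure \<Omega>) (\<lambda>x. - v x)"
    using cont by (rule continuous_on_minus)
  have ext_minus: "- v x = - u x" if "x \<in> \<Omega>" for x
    using ext[OF that] by simp
  have "v x \<le> 0" if "x \<in> frontier \<Omega>" for x
    using assms(2) F_bdry sub \<open>open \<Omega>\<close> assms(8) cont ext that by (rule nonpos_on_frontier)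
  then have upper: "u x \<le> 0" if "x \<in> \<Omega>" for x
    using nonpos_of_nonpos_on_frontier[OF F_small sub \<open>open \<Omega>\<close> assms(8) cont ext] that by blast
  have "- v x \<le> 0" if "x \<in> frontier \<Omega>" for x
    using assms(2) G_bdry super \<open>open \<Omega>\<close> bdd_minus cont_minus ext_minus that
    by (rule nonpos_on_frontier)
  then have lower: "- u x \<le> 0" if "x \<in> \<Omega>" for x
    using nonpos_of_nonpos_on_frontier[OF G_small super \<open>open \<Omega>\<close> bdd_minus cont_minus ext_minus] that
    by blast
  show ?thesis using upper lower by force
qed

end
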